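(* Let $d_1,d_2\in\{1,2,\ldots\}$, $d=d_1+d_2$, let $V\colon\mathbb{R}^d\to\mathbb{R}$ be Borel measurable, and let $p_1,p_2\in[1,\infty]$ satisfy $$\frac{d_1}{2p_1}+\frac{d_2}{2p_2}=1 .$$ (a) If $r\in(p_1,\infty]$ and $V(x_1,x_2)=V_1(x_1)V_2(x_2)$ for $x_1\in\mathbb{R}^{d_1}$, $x_2\in\mathbb{R}^{d_2}$, where $V_1\in L^{r}(\mathbb{R}^{d_1})$ and $V_2\in L^{p_2}(\mathbb{R}^{d_2})$, then for all $t>0$ $$\sup_{x,y\in\mathbb{R}^d}S(V,t,x,y)\le c\,t^{\,1-d_1/(2r)-d_2/(2p_2)},$$ where $$c=C(d_1,r)\,C(d_2,p_2)\,\frac{[\Gamma(1-d_1/(2r)-d_2/(2p_2))]^2}{\Gamma(2-d_1/r-d_2/p_2)}\,\|V_1\|_{r}\|V_2\|_{p_2}.$$ (b) If $1\le q<p_1<r\le\infty$ and $V(x_1,x_2)=V_1(x_1)V_2(x_2)$ for $x_1\in\mathbb{R}^{d_1}$, $x_2\in\mathbb{R}^{d_2}$, where $V_1\in L^{q}(\mathbb{R}^{d_1})\cap L^{r}(\mathbb{R}^{d_1})$ and $V_2\in L^{p_2}(\mathbb{R}^{d_2})$, then $$\sup_{t>0,\;x,y\in\mathbb{R}^d}S(V,t,x,y)<\infty .$$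
   Context: The Gauss-Weierstrass kernel on $\mathbb{R}^d$ is $g(t,x,y)=(4\pi t)^{-d/2}e^{-|y-x|^2/(4t)}$, $t>0$, $x,y\in\mathbb{R}^d$. For a Borel function $V$ on $\mathbb{R}^d$, $$S(V,t,x,y)=\int_0^t\int_{\mathbb{R}^d}\frac{g(s,x,z)\,g(t-s,z,y)}{g(t,x,y)}|V(z)|\,dz\,ds\in[0,\infty],\qquad t>0,\ x,y\in\mathbb{R}^d .$$ For $n\in\{1,2,\ldots\}$ and $p\in[1,\infty]$, $C(n,1)=(4\pi)^{-n/2}$ and $C(n,p)=(4\pi)^{-n/(2p)}(1-p^{-1})^{(1-p^{-1})n/2}$ for $p\in(1,\infty]$. The convention $1/\infty=0$ is used. $\Gamma$ is the Euler gamma function and $\|\cdot\|_p$ is the $L^p$ norm. *)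

theory Defs
  imports "HOL-Probability.Essential_Supremum"
begin

text \<open>
  \<open>\<real>\<^sup>d\<close> is an arbitrary type of class \<^class>\<open>euclidean_space\<close> with \<open>d = DIM('a) \<ge> 1\<close>;
  \<open>\<real>\<^bsup>d\<^sub>1 + d\<^sub>2\<^esup>\<close> is the product type \<open>'a \<times> 'b\<close>, whose norm is the Euclidean one.
\<close>

definition gauss_weierstrass :: "real \<Rightarrow> 'a::euclidean_space \<Rightarrow> 'a \<Rightarrow> real" where
  "gauss_weierstrass t x y =
     (4 * pi * t) powr (- (real DIM('a) / 2)) * exp (- ((norm (y - x))\<^sup>2 / (4 * t)))"

text \<open>The time integral is over the open interval, where both kernels have a positive time.\<close>

definition potential_S :: "('a::euclidean_space \<Rightarrow> real) \<Rightarrow> real \<Rightarrow> 'a \<Rightarrow> 'a \<Rightarrow> ennreal" where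
  "potential_S V t x y =
     (\<integral>\<^sup>+ s\<in>{0<..<t}.
        (\<integral>\<^sup>+ z. ennreal (gauss_weierstrass s x z * gauss_weierstrass (t - s) z y
                      / gauss_weierstrass t x y * \<bar>V z\<bar>) \<partial>lborel) \<partial>lborel)"

text \<open>Reciprocal of an exponent \<open>p \<in> [1, \<infinity>]\<close>, with \<open>1/\<infinity> = 0\<close>.\<close>

definition rcp :: "ennreal \<Rightarrow> real" where
  "rcp p = enn2real (1 / p)"

text \<open>The case \<open>p = 1\<close> is separate because \<open>0 powr 0 = 0\<close> in HOL.\<close>

definition C_const :: "nat \<Rightarrow> ennreal \<Rightarrow> real" where
  "C_const n p =
     (if p = 1 then (4 * pi) powr (- (real n / 2))
      else (4 * pi) powr (- (real n * rcp p / 2)) * (1 - rcp p) powr ((1 - rcp p) * real n / 2))"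

text \<open>
  Membership in \<open>L\<^sup>p(M)\<close> and the \<open>L\<^sup>p\<close> norm, for \<open>p \<in> [1, \<infinity>]\<close> and functions (not equivalence
  classes). \<open>Lp_norm\<close> is meaningful only for members of \<open>Lp_space\<close>.
\<close>

definition Lp_space :: "'a measure \<Rightarrow> ennreal \<Rightarrow> ('a \<Rightarrow> real) set" where
  "Lp_space M p =
     {f \<in> borel_measurable M.
        if p = \<infinity> then esssup M (\<lambda>x. ereal \<bar>f x\<bar>) < \<infinity>
        else integrable M (\<lambda>x. \<bar>f x\<bar> powr enn2real p)}"

definition Lp_norm :: "'a measure \<Rightarrow> ennreal \<Rightarrow> ('a \<Rightarrow> real) \<Rightarrow> real" where
  "Lp_norm M p f =
     (if p = \<infinity> then real_of_ereal (esssup M (\<lambda>x. ereal \<bar>f x\<bar>))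
      else (\<integral>x. \<bar>f x\<bar> powr enn2real p \<partial>M) powr rcp p)"

end

theory Submission
  imports Defs "HOL-Probability.Distributions"
begin

text \<open>
  The quotient \<open>g(s,x,z) g(t-s,z,y) / g(t,x,y)\<close> is the density in \<open>z\<close> of the Brownian bridge, i.e. the
  Gaussian kernel \<open>g(\<tau>,m,z)\<close> with \<open>\<tau> = s (t-s) / t\<close> and \<open>m = x + (s/t) (y-x)\<close>. It factorizes over
  \<open>\<real>\<^bsup>d\<^sub>1\<^esup> \<times> \<real>\<^bsup>d\<^sub>2\<^esup>\<close>, and the Hoelder inequality in each factor bounds the space integral by a constant
  times \<open>\<tau>\<^bsup>-\<alpha>\<^esup>\<close>, where \<open>C(d,p) \<tau>\<^bsup>-d/(2p)\<^esup>\<close> is the norm of the kernel in the conjugate exponent.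
  For \<open>r > p\<^sub>1\<close> one has \<open>\<alpha> < 1\<close> and the time integral is a Beta integral. For part (b) the exponents
  \<open>r\<close> and \<open>q\<close> give two bounds, with \<open>\<alpha> < 1 < \<beta>\<close>, whose minimum is integrable on the half-line.
\<close>

section \<open>Hoelder's inequality for nonnegative integrals\<close>

text \<open>Young's inequality is applied to \<open>f x / F powr (1/p)\<close> and
  \<open>g x / G powr (1/q)\<close> and then integrated. The normalisation requires \<open>F\<close>
  and \<open>G\<close> to be positive; if one of them is 0, the corresponding function, and hence
  the product, vanishes almost everywhere. With nonnegative integrals, the finiteness of the left
  side is part of the conclusion.\<close>

lemma nn_integral_Holder:
  fixes f g :: "'a \<Rightarrow> real"
  assumes f [measurable]: "f \<in> borel_measurable M" and g [measurable]: "g \<in> borel_measurable M"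
    and f0: "\<And>x. 0 \<le> f x" and g0: "\<And>x. 0 \<le> g x"
    and p: "1 < p" and q: "1 < q" and pq: "1 / p + 1 / q = 1"
    and F: "(\<integral>\<^sup>+x. ennreal (f x powr p) \<partial>M) = ennreal F" and F0: "0 \<le> F"
    and G: "(\<integral>\<^sup>+x. ennreal (g x powr q) \<partial>M) = ennreal G" and G0: "0 \<le> G"
  shows "(\<integral>\<^sup>+x. ennreal (f x * g x) \<partial>M) \<le> ennreal (F powr (1 / p) * G powr (1 / q))"
proof (cases "F = 0 \<or> G = 0")
  case True
  have "AE x in M. f x * g x = 0"
  proof (cases "F = 0")
    case True
    then have "(\<integral>\<^sup>+x. ennreal (f x powr p) \<partial>M) = 0" using F by simp
    then have "AE x in M. ennreal (f x powr p) = 0"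
      by (subst (asm) nn_integral_0_iff_AE) auto
    then show ?thesis by eventually_elim (auto simp: ennreal_eq_0_iff)
  next
    case False
    with True have "(\<integral>\<^sup>+x. ennreal (g x powr q) \<partial>M) = 0" using G by simp
    then have "AE x in M. ennreal (g x powr q) = 0"
      by (subst (asm) nn_integral_0_iff_AE) auto
    then show ?thesis by eventually_elim (auto simp: ennreal_eq_0_iff)
  qed
  then have "AE x in M. ennreal (f x * g x) = 0" by eventually_elim (metis ennreal_0)
  then have "(\<integral>\<^sup>+x. ennreal (f x * g x) \<partial>M) = (\<integral>\<^sup>+x. 0 \<partial>M)" by (rule nn_integral_cong_AE)
  then show ?thesis by simp
next
  case False
  then have FG: "F > 0" "G > 0" using F0 G0 by auto
  define K where "K = F powr (1 / p) * G powr (1 / q)"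
  have K: "K > 0" using FG by (simp add: K_def)
  \<comment> \<open>These are the coefficients left when Young's inequality for the normalised
    functions is multiplied by \<open>K\<close>; they satisfy
    \<open>c1 * F + c2 * G = K * (1 / p + 1 / q) = K\<close>.\<close>
  define c1 c2 where "c1 = K / (p * F)" and "c2 = K / (q * G)"
  have c: "0 \<le> c1" "0 \<le> c2" using K FG p q by (auto simp: c1_def c2_def)
  have young: "f x * g x \<le> c1 * f x powr p + c2 * g x powr q" for x
  proof -
    have "(f x / F powr (1/p)) * (g x / G powr (1/q)) \<le>
      (f x / F powr (1/p)) powr p / p + (g x / G powr (1/q)) powr q / q"
      using p q pq f0 g0 by (intro Youngs_inequality) auto
    also have "\<dots> = f x powr p / (p * F) + g x powr q / (q * G)"
      using p q f0 g0 FG by (simp add: powr_divide powr_powr mult.commute)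
    finally have "f x * g x / K \<le> f x powr p / (p * F) + g x powr q / (q * G)"
      by (simp add: K_def)
    then have "f x * g x \<le> (f x powr p / (p * F) + g x powr q / (q * G)) * K"
      using K by (simp add: pos_divide_le_eq)
    then show ?thesis by (simp add: algebra_simps c1_def c2_def)
  qed
  have "(\<integral>\<^sup>+x. ennreal (f x * g x) \<partial>M)
      \<le> (\<integral>\<^sup>+x. ennreal c1 * ennreal (f x powr p) + ennreal c2 * ennreal (g x powr q) \<partial>M)"
    using young c by (intro nn_integral_mono)
      (simp add: ennreal_mult[symmetric] ennreal_plus[symmetric] ennreal_leI del: ennreal_plus)
  also have "\<dots> = ennreal c1 * ennreal F + ennreal c2 * ennreal G"
    by (subst nn_integral_add) (auto simp: nn_integral_cmult F G)
  also have "\<dots> = ennreal (c1 * F + c2 * G)"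
    using c F0 G0 by (simp add: ennreal_mult[symmetric] ennreal_plus[symmetric] del: ennreal_plus)
  also have "c1 * F + c2 * G = K * (1 / p + 1 / q)"
    using FG p q by (simp add: c1_def c2_def field_simps)
  finally show ?thesis by (simp add: pq K_def)
qed

section \<open>Reciprocal exponents and signs of the constants\<close>

lemma rcp_ennreal: "1 \<le> a \<Longrightarrow> rcp (ennreal a) = 1 / a"
  by (simp add: rcp_def divide_ennreal flip: ennreal_1)

lemma rcp_top: "rcp \<infinity> = 0"
  by (simp add: rcp_def)

text \<open>The conditions \<open>p1 < r\<close> and \<open>q < p1\<close> act only through this
  strict inequality: they move the exponent of time strictly below or above the critical value
  1.\<close>

lemma rcp_strict_antimono:
  assumes "1 \<le> p" "p < r"
  shows "rcp r < rcp p"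
proof -
  have "p \<noteq> \<infinity>" using assms by auto
  then obtain a where a: "p = ennreal a" "0 \<le> a" by (cases p) auto
  with assms have a1: "1 \<le> a" by (simp flip: ennreal_1)
  show ?thesis
  proof (cases "r = \<infinity>")
    case True
    then show ?thesis using a a1 by (simp add: rcp_ennreal rcp_top[simplified])
  next
    case False
    then obtain b where b: "r = ennreal b" "0 \<le> b" by (cases r) auto
    with assms a have "a < b" by (simp add: ennreal_less_iff)
    then show ?thesis using a a1 b by (simp add: rcp_ennreal frac_less2)
  qed
qed

lemma rcp_nonneg: "0 \<le> rcp p"
  by (simp add: rcp_def)

lemma C_const_nonneg: "0 \<le> C_const n p"
  by (simp add: C_const_def)

lemma gauss_weierstrass_nonneg: "0 \<le> gauss_weierstrass t x y"
  by (simp add: gauss_weierstrass_def)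

section \<open>The Gaussian kernel: factorization, bridge identity, total mass and powers\<close>

lemma gauss_weierstrass_measurable [measurable]:
  "gauss_weierstrass t x \<in> borel_measurable borel"
  unfolding gauss_weierstrass_def[abs_def] by measurable

lemma gauss_weierstrass_prod:
  fixes m z :: "'a::euclidean_space \<times> 'b::euclidean_space"
  assumes "0 < t"
  shows "gauss_weierstrass t m z =
    gauss_weierstrass t (fst m) (fst z) * gauss_weierstrass t (snd m) (snd z)"
proof -
  have "(4 * pi * t) powr (- (real DIM('a \<times> 'b) / 2)) =
      (4 * pi * t) powr (- (real DIM('a) / 2)) * (4 * pi * t) powr (- (real DIM('b) / 2))"
    by (simp add: add_divide_distrib algebra_simps flip: powr_add)
  moreover have "exp (- ((norm (z - m))\<^sup>2 / (4 * t))) =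
     exp (- ((norm (fst z - fst m))\<^sup>2 / (4 * t))) * exp (- ((norm (snd z - snd m))\<^sup>2 / (4 * t)))"
    by (simp add: norm_prod_def add_divide_distrib flip: exp_add)
  ultimately show ?thesis by (simp add: gauss_weierstrass_def)
qed

text \<open>Completing the square in \<open>z\<close>: with \<open>u = z - x\<close> and
  \<open>w = y - x\<close>, the three exponents combine into a single square centred at
  \<open>(s / t) *\<^sub>R w\<close>. The prefactors combine because
  \<open>4 * pi * (s * (t - s) / t)\<close> is the product of the numerators' bases divided by
  \<open>4 * pi * t\<close>.\<close>

lemma gauss_weierstrass_bridge:
  fixes x y z :: "'a::euclidean_space"
  assumes s: "0 < s" "s < t"
  shows "gauss_weierstrass s x z * gauss_weierstrass (t - s) z y / gauss_weierstrass t x y =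
    gauss_weierstrass (s * (t - s) / t) (x + (s / t) *\<^sub>R (y - x)) z"
proof -
  define u where "u = z - x"
  define w where "w = y - x"
  have eqs: "y - z = w - u" "z - (x + (s / t) *\<^sub>R (y - x)) = u - (s / t) *\<^sub>R w"
    by (auto simp: u_def w_def)
  define A B C where "A = u \<bullet> u" and "B = u \<bullet> w" and "C = w \<bullet> w"
  have n: "(norm u)\<^sup>2 = A" "(norm w)\<^sup>2 = C" "(norm (w - u))\<^sup>2 = C - 2 * B + A"
    "(norm (u - (s / t) *\<^sub>R w))\<^sup>2 = A - 2 * (s / t) * B + (s / t)\<^sup>2 * C"
    unfolding power2_norm_eq_inner A_def B_def C_def
    by (simp_all add: inner_diff inner_commute algebra_simps power2_eq_square)
  have t: "0 < t" "0 < t - s" using s by auto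
  have E: "- (A / (4 * s)) - (C - 2 * B + A) / (4 * (t - s)) + C / (4 * t) =
     - ((A - 2 * (s / t) * B + (s / t)\<^sup>2 * C) / (4 * (s * (t - s) / t)))"
  proof -
    \<comment> \<open>Once \<open>t\<close> is replaced by \<open>v + s\<close>, only the positive
      quantities \<open>s\<close> and \<open>v\<close> occur in the denominators, and clearing them
      leaves a polynomial identity.\<close>
    define v where "v = t - s"
    have tv: "t = v + s" "v > 0" using s by (auto simp: v_def)
    have "v + s \<noteq> 0" using tv s by auto
    then show ?thesis unfolding v_def[symmetric] tv(1) using tv(2) s(1)
      by (simp add: divide_simps power2_eq_square) (simp add: algebra_simps)
  qed
  have P: "(4 * pi * s) powr k * (4 * pi * (t - s)) powr k / (4 * pi * t) powr k =
     (4 * pi * (s * (t - s) / t)) powr k" for k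
  proof -
    have "4 * pi * (s * (t - s) / t) = (4 * pi * s) * (4 * pi * (t - s)) / (4 * pi * t)"
      using t by (simp add: field_simps)
    then show ?thesis using s t by (simp only: powr_divide powr_mult)
  qed
  have "gauss_weierstrass s x z * gauss_weierstrass (t - s) z y / gauss_weierstrass t x y =
    ((4 * pi * s) powr (- (real DIM('a) / 2)) * (4 * pi * (t - s)) powr (- (real DIM('a) / 2))
       / (4 * pi * t) powr (- (real DIM('a) / 2)))
    * (exp (- (A / (4 * s))) * exp (- ((C - 2 * B + A) / (4 * (t - s)))) / exp (- (C / (4 * t))))"
    by (simp add: gauss_weierstrass_def eqs n flip: u_def w_def)
  also have "exp (- (A / (4 * s))) * exp (- ((C - 2 * B + A) / (4 * (t - s)))) / exp (- (C / (4 * t)))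
     = exp (- (A / (4 * s)) - (C - 2 * B + A) / (4 * (t - s)) + C / (4 * t))"
    by (simp add: exp_add exp_diff exp_minus field_simps)
  finally show ?thesis unfolding P E
    by (simp add: gauss_weierstrass_def eqs n)
qed

text \<open>In coordinates the kernel is a product of one-dimensional normal densities, each of
  total mass 1. Their variance is \<open>2 * t\<close>, since the exponent has the denominator
  \<open>4 * t\<close>.\<close>

lemma nn_integral_gauss_weierstrass:
  fixes m :: "'a::euclidean_space"
  assumes t: "0 < t"
  shows "(\<integral>\<^sup>+z. ennreal (gauss_weierstrass t m z) \<partial>lborel) = 1"
proof -
  define \<sigma> where "\<sigma> = sqrt (2 * t)"
  have \<sigma>: "\<sigma> > 0" "\<sigma>\<^sup>2 = 2 * t" using t by (auto simp: \<sigma>_def)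
  have eq: "gauss_weierstrass t m z = (\<Prod>b\<in>Basis. normal_density (m \<bullet> b) \<sigma> (z \<bullet> b))" for z
  proof -
    define X where "X = 4 * pi * t"
    have X: "0 < X" "2 * pi * \<sigma>\<^sup>2 = X" "2 * \<sigma>\<^sup>2 = 4 * t"
      using t by (auto simp: X_def \<sigma>)
    have nd: "normal_density (m \<bullet> b) \<sigma> (z \<bullet> b) =
      X powr (- (1 / 2)) * exp (- ((z \<bullet> b - m \<bullet> b)\<^sup>2 / (4 * t)))" for b
      unfolding normal_density_def X(2,3) powr_minus using X(1)
      by (simp add: powr_half_sqrt inverse_eq_divide)
    have "(\<Prod>b\<in>(Basis::'a set). normal_density (m \<bullet> b) \<sigma> (z \<bullet> b)) =
      (X powr (- (1 / 2))) ^ DIM('a) * exp (\<Sum>b\<in>(Basis::'a set). - ((z \<bullet> b - m \<bullet> b)\<^sup>2 / (4 * t)))"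
      unfolding nd prod.distrib by (simp add: exp_sum)
    also have "(\<Sum>b\<in>(Basis::'a set). - ((z \<bullet> b - m \<bullet> b)\<^sup>2 / (4 * t))) = - ((norm (z - m))\<^sup>2 / (4 * t))"
      unfolding power2_norm_eq_inner euclidean_inner[of "z - m" "z - m"]
      by (simp add: inner_diff_left sum_negf sum_divide_distrib power2_eq_square)
    also have "(X powr (- (1 / 2))) ^ DIM('a) = (4 * pi * t) powr (- (real DIM('a) / 2))"
      using X(1) by (subst powr_power) (auto simp: X_def)
    finally show ?thesis by (simp add: gauss_weierstrass_def)
  qed
  have "(\<integral>\<^sup>+z. ennreal (gauss_weierstrass t m z) \<partial>lborel) =
    (\<integral>\<^sup>+z. (\<Prod>b\<in>Basis. ennreal (normal_density (m \<bullet> b) \<sigma> (z \<bullet> b))) \<partial>lborel)"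
    by (simp add: eq prod_ennreal)
  also have "\<dots> = (\<Prod>b\<in>(Basis::'a set). (\<integral>\<^sup>+x. ennreal (normal_density (m \<bullet> b) \<sigma> x) \<partial>lborel))"
    by (rule nn_integral_lborel_prod) auto
  also have "\<dots> = 1"
    using \<sigma> by (simp add: nn_integral_eq_integral)
  finally show ?thesis .
qed

text \<open>A power of a Gaussian is a multiple of a Gaussian with rescaled time, so the norms of
  the kernel follow from its total mass being 1.\<close>

lemma gauss_weierstrass_powr:
  fixes m z :: "'a::euclidean_space"
  assumes t: "0 < t" and q: "0 < q"
  shows "gauss_weierstrass t m z powr q =
    (4 * pi * t) powr (real DIM('a) / 2 - real DIM('a) * q / 2) * q powr (- (real DIM('a) / 2))
      * gauss_weierstrass (t / q) m z"
proof -
  define D where "D = real DIM('a) / 2"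
  define T where "T = 4 * pi * t"
  have T: "T > 0" using t by (simp add: T_def)
  have 1: "4 * pi * (t / q) = T / q" by (simp add: T_def)
  have "gauss_weierstrass t m z powr q = T powr (- D * q) * exp (- ((norm (z - m))\<^sup>2 / (4 * (t / q))))"
    using t q by (simp add: gauss_weierstrass_def powr_mult powr_powr exp_powr_real D_def T_def
        field_simps)
  also have "T powr (- D * q) = T powr (D - D * q) * q powr (- D) * (T / q) powr (- D)"
    using T q by (simp add: powr_divide powr_add[symmetric])
  finally show ?thesis
    unfolding gauss_weierstrass_def 1 by (simp add: D_def T_def algebra_simps)
qed

section \<open>Integrals of the kernel against functions with finite norm\<close>

lemma Lp_norm_lebesgue_nonneg:
  fixes f :: "'a::euclidean_space \<Rightarrow> real"
  assumes "f \<in> Lp_space lebesgue p"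
  shows "0 \<le> Lp_norm lebesgue p f"
proof (cases "p = \<infinity>")
  case True
  have [measurable]: "f \<in> borel_measurable lebesgue" using assms by (simp add: Lp_space_def)
  have "esssup lebesgue (\<lambda>x::'a. 0::ereal) \<le> esssup lebesgue (\<lambda>x. ereal \<bar>f x\<bar>)"
    by (rule esssup_mono) auto
  \<comment> \<open>The space has positive measure here; over a null measure the essential supremum
    of a constant would be minus infinity.\<close>
  moreover have "esssup lebesgue (\<lambda>x::'a. 0::ereal) = 0"
    by (rule esssup_const) simp
  ultimately show ?thesis using True by (simp add: Lp_norm_def real_of_ereal_pos)
qed (simp add: Lp_norm_def)

text \<open>The kernel is measured in the conjugate exponent. For \<open>p = \<infinity>\<close>
  this is its total mass 1, for \<open>p = 1\<close> its maximum
  \<open>(4 * pi * t) powr (- (d / 2))\<close>, and otherwise Hoelder's inequality applies. As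
  \<open>f\<close> is only Lebesgue measurable, the estimates are made over \<open>lebesgue\<close>;
  the integral over \<open>lborel\<close> has the same value by completion.\<close>

lemma gauss_weierstrass_Holder:
  fixes f :: "'a::euclidean_space \<Rightarrow> real"
  assumes f: "f \<in> Lp_space lebesgue p" and p: "1 \<le> p" and t: "0 < t"
  shows "(\<integral>\<^sup>+z. ennreal (gauss_weierstrass t m z * \<bar>f z\<bar>) \<partial>lborel) \<le>
    ennreal (C_const DIM('a) p * Lp_norm lebesgue p f * t powr (- (real DIM('a) * rcp p / 2)))"
proof -
  define d where "d = real DIM('a)"
  have [measurable]: "f \<in> borel_measurable lebesgue" using f by (simp add: Lp_space_def)
  have [measurable]: "gauss_weierstrass t m \<in> borel_measurable lebesgue"
    by (simp add: measurable_completion)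
  show ?thesis
  proof (cases "p = \<infinity>")
    case True
    define N where "N = Lp_norm lebesgue p f"
    have "esssup lebesgue (\<lambda>x. ereal \<bar>f x\<bar>) < \<infinity>" using f True by (simp add: Lp_space_def)
    moreover have "AE x in lebesgue. ereal \<bar>f x\<bar> \<le> esssup lebesgue (\<lambda>x. ereal \<bar>f x\<bar>)"
      by (rule esssup_AE)
    ultimately have N: "AE x in lebesgue. \<bar>f x\<bar> \<le> N"
      unfolding N_def Lp_norm_def using True
      by (cases "esssup lebesgue (\<lambda>x. ereal \<bar>f x\<bar>)") auto
    have "(\<integral>\<^sup>+z. ennreal (gauss_weierstrass t m z * \<bar>f z\<bar>) \<partial>lebesgue) \<le>
       (\<integral>\<^sup>+z. ennreal (gauss_weierstrass t m z) * ennreal N \<partial>lebesgue)"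
      using N
      by (intro nn_integral_mono_AE, eventually_elim)
        (simp add: ennreal_mult gauss_weierstrass_nonneg mult_left_mono)
    also have "\<dots> = ennreal N"
      by (simp add: nn_integral_completion nn_integral_multc nn_integral_gauss_weierstrass[OF t])
    finally show ?thesis
      using True t rcp_top
      by (simp add: nn_integral_completion C_const_def N_def)
  next
    case False
    then obtain a where a: "p = ennreal a" "0 \<le> a" by (cases p) auto
    with p have a1: "1 \<le> a" by (simp flip: ennreal_1)
    define F where "F = (\<integral>x. \<bar>f x\<bar> powr a \<partial>lebesgue)"
    have F0: "0 \<le> F" by (simp add: F_def)
    have int: "integrable lebesgue (\<lambda>x. \<bar>f x\<bar> powr a)"
      using f a False by (simp add: Lp_space_def)
    have F: "(\<integral>\<^sup>+x. ennreal (\<bar>f x\<bar> powr a) \<partial>lebesgue) = ennreal F"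
      unfolding F_def by (rule nn_integral_eq_integral[OF int]) simp
    have norm: "Lp_norm lebesgue p f = F powr (1 / a)"
      using a a1 by (simp add: Lp_norm_def F_def rcp_ennreal)
    show ?thesis
    proof (cases "a = 1")
      case True
      define c where "c = (4 * pi * t) powr (- (d / 2))"
      have le: "gauss_weierstrass t m z \<le> c" for z
        using t by (simp add: gauss_weierstrass_def c_def d_def mult_le_cancel_left2)
      have "(\<integral>\<^sup>+z. ennreal (gauss_weierstrass t m z * \<bar>f z\<bar>) \<partial>lebesgue) \<le>
          (\<integral>\<^sup>+z. ennreal c * ennreal (\<bar>f z\<bar> powr a) \<partial>lebesgue)"
        using le by (intro nn_integral_mono)
          (auto simp: True c_def ennreal_mult[symmetric] mult_right_mono intro!: ennreal_leI)
      also have "\<dots> = ennreal c * ennreal F"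
        by (subst nn_integral_cmult) (auto simp: F)
      also have "\<dots> = ennreal (c * F)" using F0 by (simp add: ennreal_mult c_def)
      also have "c * F = C_const DIM('a) p * Lp_norm lebesgue p f * t powr (- (real DIM('a) * rcp p / 2))"
      proof -
        have "Lp_norm lebesgue p f = F" using norm True F0 by simp
        moreover have "p = 1" using a True by simp
        ultimately show ?thesis
          using t rcp_ennreal[of 1] by (simp add: C_const_def c_def d_def powr_mult)
      qed
      finally show ?thesis by (simp add: nn_integral_completion)
    next
      case False
      with a1 have a1: "1 < a" by simp
      define q where "q = a / (a - 1)"
      have q: "1 < q" "1 / q = 1 - 1 / a" "1 / a + 1 / q = 1"
        using a1 by (auto simp: q_def field_simps)
      define T where "T = 4 * pi * t"
      have T: "T > 0" using t by (simp add: T_def)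
      define G where "G = T powr (d / 2 - d * q / 2) * q powr (- (d / 2))"
      have G0: "0 \<le> G" by (simp add: G_def)
      have "(\<integral>\<^sup>+x. ennreal (gauss_weierstrass t m x powr q) \<partial>lebesgue) =
         (\<integral>\<^sup>+x. ennreal G * ennreal (gauss_weierstrass (t / q) m x) \<partial>lborel)"
        using t q G0 by (simp add: nn_integral_completion gauss_weierstrass_powr G_def T_def d_def
            ennreal_mult gauss_weierstrass_nonneg)
      also have "\<dots> = ennreal G"
        using t q by (subst nn_integral_cmult) (auto simp: nn_integral_gauss_weierstrass)
      finally have G: "(\<integral>\<^sup>+x. ennreal (gauss_weierstrass t m x powr q) \<partial>lebesgue) = ennreal G" .
      have "(\<integral>\<^sup>+z. ennreal (\<bar>f z\<bar> * gauss_weierstrass t m z) \<partial>lebesgue) \<le>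
         ennreal (F powr (1 / a) * G powr (1 / q))"
        by (rule nn_integral_Holder[OF _ _ _ _ a1 q(1,3) F F0 G G0])
          (auto simp: gauss_weierstrass_nonneg)
      \<comment> \<open>This root is the norm of the kernel in the exponent \<open>q\<close>. The
        factor \<open>(1 - 1 / a) powr ((1 - 1 / a) * d / 2)\<close> of \<open>C_const\<close> comes
        from the power of \<open>q\<close> in \<open>G\<close>, because
        \<open>1 / q = 1 - 1 / a\<close>.\<close>
      also have "G powr (1 / q) = T powr (- (d * (1 / a) / 2)) * (1 - 1 / a) powr ((1 - 1 / a) * d / 2)"
      proof -
        have "G powr (1 / q) = T powr ((d / 2 - d * q / 2) * (1 / q)) * q powr (- (d / 2) * (1 / q))"
          by (simp add: G_def powr_mult powr_powr)
        also have "(d / 2 - d * q / 2) * (1 / q) = d / 2 * (1 / q) - d / 2"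
          using q(1) by (simp add: field_simps)
        also have "\<dots> = - (d * (1 / a) / 2)" unfolding q(2) by (simp add: right_diff_distrib)
        also have "q powr (- (d / 2) * (1 / q)) = (1 / q) powr ((1 / q) * d / 2)"
          using q(1) by (simp add: powr_minus_divide powr_divide mult.commute)
        finally show ?thesis by (simp add: q(2))
      qed
      also have "F powr (1 / a) * (T powr (- (d * (1 / a) / 2)) * (1 - 1 / a) powr ((1 - 1 / a) * d / 2))
         = C_const DIM('a) p * Lp_norm lebesgue p f * t powr (- (real DIM('a) * rcp p / 2))"
      proof -
        have "p \<noteq> 1" using a a1 by (simp add: ennreal_eq_1)
        moreover have "rcp p = 1 / a" using a a1 by (simp add: rcp_ennreal)
        ultimately show ?thesis using t
          by (simp add: norm C_const_def T_def d_def powr_mult)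
      qed
      finally show ?thesis by (simp add: nn_integral_completion mult.commute)
    qed
  qed
qed

section \<open>The space integral for product potentials\<close>

text \<open>Both the kernel and \<open>V\<close> split into factors, so Tonelli's theorem turns the
  integral into a product of two integrals, and the one-factor bound applies to each.\<close>

lemma gauss_weierstrass_product_bound:
  fixes V :: "'a::euclidean_space \<times> 'b::euclidean_space \<Rightarrow> real"
  assumes V [measurable]: "V \<in> borel_measurable borel"
    and V1: "V1 \<in> Lp_space lebesgue r" and V2: "V2 \<in> Lp_space lebesgue p"
    and prod: "\<And>x1 x2. V (x1, x2) = V1 x1 * V2 x2"
    and r: "1 \<le> r" and p: "1 \<le> p" and t: "0 < t"
  shows "(\<integral>\<^sup>+z. ennreal (gauss_weierstrass t m z * \<bar>V z\<bar>) \<partial>lborel) \<le>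
    ennreal (C_const DIM('a) r * C_const DIM('b) p * Lp_norm lebesgue r V1 * Lp_norm lebesgue p V2
      * t powr (- (real DIM('a) * rcp r / 2 + real DIM('b) * rcp p / 2)))"
\<comment> \<open>The zero potential is treated apart because it does not determine its factors: if
  \<open>V2\<close> is 0, then \<open>V1\<close> cannot be recovered from \<open>V\<close>.\<close>
proof (cases "\<forall>z. V z = 0")
  case True
  then have "V z = 0" for z by blast
  then show ?thesis by simp
next
  case False
  then obtain a b where "V (a, b) \<noteq> 0" by auto
  then have nz: "V1 a \<noteq> 0" "V2 b \<noteq> 0" by (auto simp: prod)
  \<comment> \<open>\<open>V1\<close> and \<open>V2\<close> are only assumed Lebesgue measurable; as rescaled slices of \<open>V\<close> they are Borel.\<close>
  have [measurable]: "V1 \<in> borel_measurable borel"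
  proof -
    have "(\<lambda>x. V (x, b) / V2 b) \<in> borel_measurable borel" by measurable
    then show ?thesis using nz by (simp add: prod)
  qed
  have [measurable]: "V2 \<in> borel_measurable borel"
  proof -
    have "(\<lambda>x. V (a, x) / V1 a) \<in> borel_measurable borel" by measurable
    then show ?thesis using nz by (simp add: prod)
  qed
  obtain m1 m2 where m: "m = (m1, m2)" by force
  define K1 where "K1 = C_const DIM('a) r * Lp_norm lebesgue r V1 * t powr (- (real DIM('a) * rcp r / 2))"
  define K2 where "K2 = C_const DIM('b) p * Lp_norm lebesgue p V2 * t powr (- (real DIM('b) * rcp p / 2))"
  have K: "0 \<le> K1" "0 \<le> K2"
    using V1 V2 by (auto simp: K1_def K2_def C_const_nonneg Lp_norm_lebesgue_nonneg)
  have "(\<integral>\<^sup>+z. ennreal (gauss_weierstrass t m z * \<bar>V z\<bar>) \<partial>lborel) =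
     (\<integral>\<^sup>+z. ennreal (gauss_weierstrass t m z * \<bar>V z\<bar>) \<partial>(lborel \<Otimes>\<^sub>M lborel))"
    by (simp add: lborel_prod)
  also have "\<dots> = (\<integral>\<^sup>+z1. \<integral>\<^sup>+z2. ennreal (gauss_weierstrass t m (z1, z2) * \<bar>V (z1, z2)\<bar>) \<partial>lborel \<partial>lborel)"
    by (rule lborel.nn_integral_fst[symmetric]) (simp add: lborel_prod)
  also have "\<dots> = (\<integral>\<^sup>+z1. \<integral>\<^sup>+z2. ennreal (gauss_weierstrass t m1 z1 * \<bar>V1 z1\<bar>) *
       ennreal (gauss_weierstrass t m2 z2 * \<bar>V2 z2\<bar>) \<partial>lborel \<partial>lborel)"
    by (simp add: gauss_weierstrass_prod[OF t] m prod abs_mult ennreal_mult[symmetric]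
        gauss_weierstrass_nonneg mult_ac)
  also have "\<dots> = (\<integral>\<^sup>+z1. ennreal (gauss_weierstrass t m1 z1 * \<bar>V1 z1\<bar>) \<partial>lborel) *
       (\<integral>\<^sup>+z2. ennreal (gauss_weierstrass t m2 z2 * \<bar>V2 z2\<bar>) \<partial>lborel)"
    by (simp add: nn_integral_cmult nn_integral_multc)
  also have "\<dots> \<le> ennreal K1 * ennreal K2"
    unfolding K1_def K2_def
    by (intro mult_mono gauss_weierstrass_Holder V1 V2 r p t) auto
  also have "\<dots> = ennreal (K1 * K2)" using K by (simp add: ennreal_mult)
  finally show ?thesis
    unfolding K1_def K2_def minus_add_distrib powr_add by (simp only: mult_ac)
qed

lemma potential_S_inner_bound:
  fixes V :: "'a::euclidean_space \<times> 'b::euclidean_space \<Rightarrow> real"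
  assumes "V \<in> borel_measurable borel"
    and "V1 \<in> Lp_space lebesgue r" and "V2 \<in> Lp_space lebesgue p"
    and "\<And>x1 x2. V (x1, x2) = V1 x1 * V2 x2"
    and "1 \<le> r" and "1 \<le> p" and s: "0 < s" "s < t"
  shows "(\<integral>\<^sup>+ z. ennreal (gauss_weierstrass s x z * gauss_weierstrass (t - s) z y
        / gauss_weierstrass t x y * \<bar>V z\<bar>) \<partial>lborel) \<le>
    ennreal (C_const DIM('a) r * C_const DIM('b) p * Lp_norm lebesgue r V1 * Lp_norm lebesgue p V2
      * (s * (t - s) / t) powr (- (real DIM('a) * rcp r / 2 + real DIM('b) * rcp p / 2)))"
  unfolding gauss_weierstrass_bridge[OF s]
  using s by (intro gauss_weierstrass_product_bound assms) auto

section \<open>Time integrals of powers of the bridge variance\<close>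

text \<open>The substitution \<open>s = t * u\<close> turns \<open>s * (t - s) / t\<close> into
  \<open>t * (u * (1 - u))\<close>. A power of \<open>t\<close> comes out, and what remains is the
  Beta integral with both parameters \<open>1 - \<alpha>\<close>, which converges as \<alpha> <
  1.\<close>

lemma nn_integral_bridge_time:
  fixes \<alpha> t :: real
  assumes \<alpha>: "\<alpha> < 1" and t: "0 < t"
  shows "(\<integral>\<^sup>+ s\<in>{0<..<t}. ennreal ((s * (t - s) / t) powr (- \<alpha>)) \<partial>lborel) \<le>
    ennreal (t powr (1 - \<alpha>) * ((Gamma (1 - \<alpha>))\<^sup>2 / Gamma (2 - 2 * \<alpha>)))"
proof -
  define B where "B = Beta (1 - \<alpha>) (1 - \<alpha>)"
  have B: "B = (Gamma (1 - \<alpha>))\<^sup>2 / Gamma (2 - 2 * \<alpha>)"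
    by (simp add: B_def Beta_def power2_eq_square)
  have "((\<lambda>u. u powr (1 - \<alpha> - 1) * (1 - u) powr (1 - \<alpha> - 1)) has_integral B) {0..1}"
    unfolding B_def using \<alpha> by (intro has_integral_Beta_real) auto
  then have "((\<lambda>u. u powr (- \<alpha>) * (1 - u) powr (- \<alpha>)) has_integral B) {0..1}" by simp
  from nn_integral_has_integral_lebesgue'[OF _ this]
  have I: "(\<integral>\<^sup>+ u\<in>{0..1}. ennreal (u powr (- \<alpha>) * (1 - u) powr (- \<alpha>)) \<partial>lborel) = ennreal B" by simp
  have "(\<integral>\<^sup>+ s\<in>{0<..<t}. ennreal ((s * (t - s) / t) powr (- \<alpha>)) \<partial>lborel) =
    ennreal t * (\<integral>\<^sup>+ u. ennreal (((t * u) * (t - t * u) / t) powr (- \<alpha>)) * indicator {0<..<t} (t * u) \<partial>lborel)"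
    using t by (subst nn_integral_real_affine[where c = t and t = 0]) auto
  also have "\<dots> \<le> ennreal t * (\<integral>\<^sup>+ u. ennreal (t powr (- \<alpha>)) *
      (ennreal (u powr (- \<alpha>) * (1 - u) powr (- \<alpha>)) * indicator {0..1} u) \<partial>lborel)"
  proof (intro mult_left_mono nn_integral_mono)
    fix u :: real
    show "ennreal (((t * u) * (t - t * u) / t) powr (- \<alpha>)) * indicator {0<..<t} (t * u)
      \<le> ennreal (t powr (- \<alpha>)) * (ennreal (u powr (- \<alpha>) * (1 - u) powr (- \<alpha>)) * indicator {0..1} u)"
    proof (cases "0 < t * u \<and> t * u < t")
      case True
      then have u: "0 < u" "u < 1" using t by (auto simp: zero_less_mult_iff)
      have "(t * u) * (t - t * u) / t = t * (u * (1 - u))" using t by (simp add: field_simps)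
      then show ?thesis using u t by (simp add: powr_mult ennreal_mult[symmetric])
    qed auto
  qed auto
  also have "\<dots> = ennreal t * (ennreal (t powr (- \<alpha>)) * ennreal B)"
    by (subst nn_integral_cmult) (auto simp: I)
  also have "\<dots> = ennreal (t * t powr (- \<alpha>) * B)"
    using t \<alpha> by (simp add: ennreal_mult[symmetric] ennreal_mult' mult_ac B Gamma_real_pos less_imp_le)
  also have "t * t powr (- \<alpha>) = t powr (1 - \<alpha>)" using t by (simp add: powr_diff powr_minus field_simps)
  finally show ?thesis by (simp add: B)
qed

text \<open>
  The bound is uniform in \<open>t\<close> because \<open>s (t - s) / t \<ge> min s (t - s) / 2\<close>, so a decreasing function of
  \<open>s (t - s) / t\<close> is at most the sum of its values at \<open>s / 2\<close> and \<open>(t - s) / 2\<close>.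
\<close>

lemma nn_integral_bridge_time_min:
  fixes \<alpha> \<beta> A B :: real
  assumes \<alpha>: "0 \<le> \<alpha>" "\<alpha> < 1" and \<beta>: "1 < \<beta>" and A: "0 \<le> A" and B: "0 \<le> B"
  shows "\<exists>H < \<infinity>. \<forall>t>0. (\<integral>\<^sup>+ s\<in>{0<..<t}. ennreal (min (A * (s * (t - s) / t) powr (- \<alpha>))
      (B * (s * (t - s) / t) powr (- \<beta>))) \<partial>lborel) \<le> H"
proof -
  define k where "k u = min (A * u powr (- \<alpha>)) (B * u powr (- \<beta>))" for u
  \<comment> \<open>This is the value at \<open>s / 2\<close>, extended by 0 to nonpositive
    \<open>s\<close>. Its integral over the whole line does not involve \<open>t\<close> and yields
    the uniform bound.\<close>
  define h where "h s = ennreal (k (s / 2)) * indicator {0<..} s" for s :: real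
  have [measurable]: "k \<in> borel_measurable borel" unfolding k_def[abs_def] by measurable
  have [measurable]: "h \<in> borel_measurable borel" unfolding h_def[abs_def] by measurable
  have k_nonneg: "0 \<le> k u" for u using A B by (simp add: k_def)
  have k_anti: "k v \<le> k u" if "0 < u" "u \<le> v" for u v
    unfolding k_def using that \<alpha> \<beta> A B
    by (intro min.mono mult_left_mono powr_mono2') auto
  have fin: "(\<integral>\<^sup>+s. h s \<partial>lborel) < \<infinity>"
  proof -
    have 1: "(\<integral>\<^sup>+ s\<in>{0..1}. ennreal (s powr (- \<alpha>)) \<partial>lborel) = ennreal (1 powr (- \<alpha> + 1) / (- \<alpha> + 1))"
      using \<alpha> by (intro nn_integral_has_integral_lebesgue' has_integral_powr_from_0) auto
    have 2: "(\<integral>\<^sup>+ s\<in>{1..}. ennreal (s powr (- \<beta>)) \<partial>lborel) = ennreal (- (1 powr (- \<beta> + 1)) / (- \<beta> + 1))"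
      using \<beta> by (intro nn_integral_has_integral_lebesgue' has_integral_powr_to_inf) auto
    \<comment> \<open>Up to 1 the first power is integrable because \<alpha> < 1, and beyond 1 the
      second is because \<beta> > 1. The powers of 2 come from evaluating \<open>k\<close> at
      \<open>s / 2\<close>. Both intervals contain 1, which is harmless in an upper bound.\<close>
    have "(\<integral>\<^sup>+s. h s \<partial>lborel) \<le> (\<integral>\<^sup>+s. ennreal (A * 2 powr \<alpha>) * (ennreal (s powr (- \<alpha>)) * indicator {0..1} s)
       + ennreal (B * 2 powr \<beta>) * (ennreal (s powr (- \<beta>)) * indicator {1..} s) \<partial>lborel)"
    proof (intro nn_integral_mono)
      fix s :: real
      have e: "(s / 2) powr (- \<gamma>) = 2 powr \<gamma> * s powr (- \<gamma>)" if "s > 0" for \<gamma>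
        using that by (simp add: powr_divide powr_minus field_simps)
      have "k (s / 2) \<le> A * 2 powr \<alpha> * s powr (- \<alpha>)" "k (s / 2) \<le> B * 2 powr \<beta> * s powr (- \<beta>)" if "s > 0"
        using e[OF that] by (simp_all add: k_def)
      then show "h s \<le> ennreal (A * 2 powr \<alpha>) * (ennreal (s powr (- \<alpha>)) * indicator {0..1} s)
       + ennreal (B * 2 powr \<beta>) * (ennreal (s powr (- \<beta>)) * indicator {1..} s)"
        using A B by (cases "s > 0"; cases "s < 1"; cases "s = 1")
          (auto simp: h_def ennreal_mult[symmetric] ennreal_plus[symmetric] add_increasing2
            simp del: ennreal_plus intro!: ennreal_leI)
    qed
    also have "\<dots> = ennreal (A * 2 powr \<alpha>) * ennreal (1 powr (- \<alpha> + 1) / (- \<alpha> + 1))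
       + ennreal (B * 2 powr \<beta>) * ennreal (- (1 powr (- \<beta> + 1)) / (- \<beta> + 1))"
      by (subst nn_integral_add) (auto simp: nn_integral_cmult 1 2)
    also have "\<dots> < \<infinity>" by (simp add: ennreal_mult_less_top)
    finally show ?thesis .
  qed
  have "(\<integral>\<^sup>+ s\<in>{0<..<t}. ennreal (k (s * (t - s) / t)) \<partial>lborel) \<le> 2 * (\<integral>\<^sup>+s. h s \<partial>lborel)"
    if t: "0 < t" for t
  proof -
    have "(\<integral>\<^sup>+ s\<in>{0<..<t}. ennreal (k (s * (t - s) / t)) \<partial>lborel) \<le> (\<integral>\<^sup>+s. h s + h (t - s) \<partial>lborel)"
    proof (intro nn_integral_mono)
      fix s
      show "ennreal (k (s * (t - s) / t)) * indicator {0<..<t} s \<le> h s + h (t - s)"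
      proof (cases "0 < s \<and> s < t")
        case True
        then have s: "0 < s" "0 < t - s" by auto
        have "k (s * (t - s) / t) \<le> k (s / 2) + k ((t - s) / 2)"
        proof (cases "s \<le> t - s")
          case True
          then have "s / 2 \<le> s * (t - s) / t" using s t by (simp add: field_simps)
          then show ?thesis using k_anti[of "s / 2" "s * (t - s) / t"] s k_nonneg[of "(t - s) / 2"] by simp
        next
          case False
          then have "(t - s) * t \<le> (t - s) * (2 * s)" using s by (intro mult_left_mono) auto
          then have "(t - s) / 2 \<le> s * (t - s) / t" using t by (simp add: field_simps)
          then show ?thesis using k_anti[of "(t - s) / 2" "s * (t - s) / t"] s k_nonneg[of "s / 2"] by simp
        qed
        then show ?thesis using s k_nonneg
          by (simp add: h_def ennreal_plus[symmetric] ennreal_leI del: ennreal_plus)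
      qed auto
    qed
    also have "\<dots> = (\<integral>\<^sup>+s. h s \<partial>lborel) + (\<integral>\<^sup>+s. h (t - s) \<partial>lborel)"
      by (rule nn_integral_add) auto
    \<comment> \<open>The reflection of \<open>s\<close> to \<open>t - s\<close> preserves Lebesgue
      measure, so this integral no longer depends on \<open>t\<close>.\<close>
    also have "(\<integral>\<^sup>+s. h (t - s) \<partial>lborel) = (\<integral>\<^sup>+s. h s \<partial>lborel)"
      using nn_integral_real_affine[of h "-1" t] by simp
    finally show ?thesis by (simp add: mult_2)
  qed
  with fin show ?thesis unfolding k_def
    by (intro exI[of _ "2 * (\<integral>\<^sup>+s. h s \<partial>lborel)"]) (auto simp: ennreal_mult_less_top)
qed

section \<open>The two estimates for the potential\<close>

theorem theorem2p9:
  fixes V :: "'a::euclidean_space \<times> 'b::euclidean_space \<Rightarrow> real"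
    and p1 p2 :: ennreal
  assumes V: "V \<in> borel_measurable borel"
    and p1: "1 \<le> p1" and p2: "1 \<le> p2"
    and p12: "real DIM('a) * rcp p1 / 2 + real DIM('b) * rcp p2 / 2 = 1"
  shows
    "(\<forall>r V1 V2. p1 < r
        \<and> V1 \<in> Lp_space lebesgue r \<and> V2 \<in> Lp_space lebesgue p2
        \<and> (\<forall>x1 x2. V (x1, x2) = V1 x1 * V2 x2) \<longrightarrow>
        (let e = 1 - real DIM('a) * rcp r / 2 - real DIM('b) * rcp p2 / 2;
             c = C_const DIM('a) r * C_const DIM('b) p2
                 * ((Gamma e)\<^sup>2 / Gamma (2 - real DIM('a) * rcp r - real DIM('b) * rcp p2))
                 * Lp_norm lebesgue r V1 * Lp_norm lebesgue p2 V2
         in \<forall>t>0. (SUP (x, y) \<in> UNIV. potential_S V t x y) \<le> ennreal (c * t powr e)))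
     \<and>
     (\<forall>q r V1 V2. 1 \<le> q \<and> q < p1 \<and> p1 < r
        \<and> V1 \<in> Lp_space lebesgue q \<inter> Lp_space lebesgue r \<and> V2 \<in> Lp_space lebesgue p2
        \<and> (\<forall>x1 x2. V (x1, x2) = V1 x1 * V2 x2) \<longrightarrow>
        (SUP (t, x, y) \<in> {0<..} \<times> UNIV \<times> UNIV. potential_S V t x y) < \<infinity>)"
proof (intro conjI allI impI, goal_cases)
  case (1 r V1 V2)
  then have r: "p1 < r" and V1: "V1 \<in> Lp_space lebesgue r" and V2: "V2 \<in> Lp_space lebesgue p2"
    and prod: "\<And>x1 x2. V (x1, x2) = V1 x1 * V2 x2" by auto
  define \<alpha> where "\<alpha> = real DIM('a) * rcp r / 2 + real DIM('b) * rcp p2 / 2"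
  define K where "K = C_const DIM('a) r * C_const DIM('b) p2 * Lp_norm lebesgue r V1 * Lp_norm lebesgue p2 V2"
  have K: "0 \<le> K" using V1 V2 by (simp add: K_def C_const_nonneg Lp_norm_lebesgue_nonneg)
  have "real DIM('a) * rcp r < real DIM('a) * rcp p1"
    using rcp_strict_antimono[OF p1 r] by simp
  \<comment> \<open>By \<open>p12\<close> the exponent equals 1 when \<open>r\<close> is replaced by
    \<open>p1\<close>; passing to the larger \<open>r\<close> lowers it strictly.\<close>
  then have \<alpha>: "\<alpha> < 1" using p12 unfolding \<alpha>_def by linarith
  have eqs: "1 - real DIM('a) * rcp r / 2 - real DIM('b) * rcp p2 / 2 = 1 - \<alpha>"
    "2 - real DIM('a) * rcp r - real DIM('b) * rcp p2 = 2 - 2 * \<alpha>"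
    by (simp_all add: \<alpha>_def)
  have bound: "potential_S V t x y \<le> ennreal (K * ((Gamma (1 - \<alpha>))\<^sup>2 / Gamma (2 - 2 * \<alpha>)) * t powr (1 - \<alpha>))"
    if t: "0 < t" for t x y
  proof -
    have "potential_S V t x y \<le>
      (\<integral>\<^sup>+ s. ennreal K * (ennreal ((s * (t - s) / t) powr (- \<alpha>)) * indicator {0<..<t} s) \<partial>lborel)"
      unfolding potential_S_def
    proof (intro nn_integral_mono)
      fix s
      show "(\<integral>\<^sup>+ z. ennreal (gauss_weierstrass s x z * gauss_weierstrass (t - s) z y
            / gauss_weierstrass t x y * \<bar>V z\<bar>) \<partial>lborel) * indicator {0<..<t} s
        \<le> ennreal K * (ennreal ((s * (t - s) / t) powr (- \<alpha>)) * indicator {0<..<t} s)"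
      proof (cases "0 < s \<and> s < t")
        case True
        then show ?thesis
          using potential_S_inner_bound[OF V V1 V2 prod _ p2, of s t x y] p1 r K
          by (simp add: K_def \<alpha>_def ennreal_mult)
      qed auto
    qed
    also have "\<dots> = ennreal K * (\<integral>\<^sup>+ s\<in>{0<..<t}. ennreal ((s * (t - s) / t) powr (- \<alpha>)) \<partial>lborel)"
      by (rule nn_integral_cmult) auto
    also have "\<dots> \<le> ennreal K * ennreal (t powr (1 - \<alpha>) * ((Gamma (1 - \<alpha>))\<^sup>2 / Gamma (2 - 2 * \<alpha>)))"
      by (intro mult_left_mono nn_integral_bridge_time \<alpha> t) auto
    also have "\<dots> = ennreal (K * ((Gamma (1 - \<alpha>))\<^sup>2 / Gamma (2 - 2 * \<alpha>)) * t powr (1 - \<alpha>))"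
      using K by (simp add: ennreal_mult'[symmetric] mult_ac)
    finally show ?thesis .
  qed
  show ?case
    unfolding Let_def eqs using bound
    by (auto intro!: SUP_least simp: K_def mult_ac)
next
  case (2 q r V1 V2)
  then have q: "1 \<le> q" "q < p1" and r: "p1 < r"
    and V1: "V1 \<in> Lp_space lebesgue r" and V1': "V1 \<in> Lp_space lebesgue q"
    and V2: "V2 \<in> Lp_space lebesgue p2"
    and prod: "\<And>x1 x2. V (x1, x2) = V1 x1 * V2 x2" by auto
  define \<alpha> where "\<alpha> = real DIM('a) * rcp r / 2 + real DIM('b) * rcp p2 / 2"
  define \<beta> where "\<beta> = real DIM('a) * rcp q / 2 + real DIM('b) * rcp p2 / 2"
  define A where "A = C_const DIM('a) r * C_const DIM('b) p2 * Lp_norm lebesgue r V1 * Lp_norm lebesgue p2 V2"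
  define B where "B = C_const DIM('a) q * C_const DIM('b) p2 * Lp_norm lebesgue q V1 * Lp_norm lebesgue p2 V2"
  have A: "0 \<le> A" and B: "0 \<le> B"
    using V1 V1' V2 by (auto simp: A_def B_def C_const_nonneg Lp_norm_lebesgue_nonneg)
  have "real DIM('a) * rcp r < real DIM('a) * rcp p1" "real DIM('a) * rcp p1 < real DIM('a) * rcp q"
    using rcp_strict_antimono[OF p1 r] rcp_strict_antimono[OF q] by auto
  \<comment> \<open>The critical exponent 1, attained at \<open>p1\<close>, lies strictly between
    the exponents belonging to \<open>r\<close> and \<open>q\<close>.\<close>
  then have \<alpha>: "0 \<le> \<alpha>" "\<alpha> < 1" and \<beta>: "1 < \<beta>"
    using p12 rcp_nonneg[of r] rcp_nonneg[of p2] unfolding \<alpha>_def \<beta>_def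
    by (simp_all only: divide_nonneg_nonneg add_nonneg_nonneg mult_nonneg_nonneg of_nat_0_le_iff)
  \<comment> \<open>\<open>H\<close> is chosen before \<open>t\<close>, \<open>x\<close> and
    \<open>y\<close>, so it bounds the supremum over all of them.\<close>
  obtain H where H: "H < \<infinity>" "\<And>t. 0 < t \<Longrightarrow> (\<integral>\<^sup>+ s\<in>{0<..<t}. ennreal (min (A * (s * (t - s) / t) powr (- \<alpha>))
      (B * (s * (t - s) / t) powr (- \<beta>))) \<partial>lborel) \<le> H"
    using nn_integral_bridge_time_min[OF \<alpha> \<beta> A B] by blast
  have bound: "potential_S V t x y \<le> H" if t: "0 < t" for t x y
  proof -
    have "potential_S V t x y \<le> (\<integral>\<^sup>+ s\<in>{0<..<t}. ennreal (min (A * (s * (t - s) / t) powr (- \<alpha>))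
      (B * (s * (t - s) / t) powr (- \<beta>))) \<partial>lborel)"
      unfolding potential_S_def
    proof (intro nn_integral_mono)
      fix s
      show "(\<integral>\<^sup>+ z. ennreal (gauss_weierstrass s x z * gauss_weierstrass (t - s) z y
            / gauss_weierstrass t x y * \<bar>V z\<bar>) \<partial>lborel) * indicator {0<..<t} s
        \<le> ennreal (min (A * (s * (t - s) / t) powr (- \<alpha>)) (B * (s * (t - s) / t) powr (- \<beta>)))
          * indicator {0<..<t} s"
      proof (cases "0 < s \<and> s < t")
        case True
        \<comment> \<open>Both memberships of \<open>V1\<close> bound the same space integral, so
          the minimum of the two bounds holds for each \<open>s\<close>.\<close>
        then show ?thesis
          using potential_S_inner_bound[OF V V1 V2 prod _ p2, of s t x y]
            potential_S_inner_bound[OF V V1' V2 prod q(1) p2, of s t x y] p1 r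
          by (simp add: A_def B_def \<alpha>_def \<beta>_def min_def)
      qed auto
    qed
    also have "\<dots> \<le> H" by (rule H(2)[OF t])
    finally show ?thesis .
  qed
  have "(SUP (t, x, y) \<in> {0<..} \<times> UNIV \<times> UNIV. potential_S V t x y) \<le> H"
    using bound by (auto intro!: SUP_least)
  then show ?case using H(1) by (rule order_le_less_trans)
qed

end
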